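(* For every real $\gamma$ with $0<\gamma<\frac{1}{2}$, there exists a constant $C(\gamma)$ such that for every real $X>3$, every prime $q$, and every integer $a$ coprime with $q$, one has $$ \left|E(X,q,a)\right| \leq C(\gamma)\left( \frac{X^{\frac13}(\log\log X)^{\frac73}}{(\log X)^{\frac16-\frac{\gamma}{3}}}+\frac{X(\log\log X)^2}{q(\log X)^{\frac{\gamma}{2}}}\right). $$
   Context: Let $\mu$ be the Möbius function, so $\mu^2$ is the indicator function of squarefree positive integers, and let $\varphi$ be Euler's totient function. For real $X>0$, an integer $q\geq 1$ and an integer $a$ coprime to $q$, define $$ E(X,q,a):=\sum_{\substack{n\leq X\\ n\equiv a \pmod q}}\mu^2(n)-\frac{1}{\varphi(q)}\sum_{\substack{n\leq X\\ (n,q)=1}}\mu^2(n), $$ where $n$ runs over positive integers. *)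

theory Defs
  imports Complex_Main "HOL-Number_Theory.Number_Theory" "HOL-Computational_Algebra.Squarefree"
begin

definition moebius_mu :: "nat \<Rightarrow> int" where
  "moebius_mu n = (if squarefree n then (-1) ^ card (prime_factors n) else 0)"

definition E :: "real \<Rightarrow> nat \<Rightarrow> int \<Rightarrow> real" where
  "E X q a =
     (\<Sum>n | 0 < n \<and> real n \<le> X \<and> [int n = a] (mod int q). real_of_int ((moebius_mu n)\<^sup>2))
     - 1 / real (totient q) *
       (\<Sum>n | 0 < n \<and> real n \<le> X \<and> coprime n q. real_of_int ((moebius_mu n)\<^sup>2))"

end

theory Submission
  imports Defs "HOL-Real_Asymp.Real_Asymp" "HOL-Analysis.Complex_Transcendental"
begin

text \<open>
  Detect squarefreeness by \<open>\<mu>\<^sup>2(n) = \<Sum>d\<^sup>2|n. \<mu>(d)\<close>. With \<open>L = ln X\<close>, the \<open>d\<close> up to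
  \<open>D0 = X powr (1/3) * L powr (-1/6)\<close> contribute at most \<open>1\<close> each. For \<open>d\<close> beyond
  \<open>D1 = D0 * L powr (1/4)\<close> one fixes the cofactor \<open>m\<close> and uses that \<open>d\<^sup>2 * m \<equiv> a\<close> has at most
  two solutions modulo \<open>q\<close>. There remain the \<open>d\<close> between \<open>D0\<close> and \<open>D1\<close> for which
  \<open>d\<^sup>2 * m \<equiv> a\<close> has a small solution \<open>m\<close>. If such a \<open>d\<close> has a prime factor \<open>p\<close> between
  \<open>P0 = L powr (3/2)\<close> and \<open>P1 = X powr (1/24)\<close>, write \<open>d = p * e\<close>: for given \<open>e\<close> the residue
  class of \<open>m * p\<^sup>2\<close> modulo \<open>q\<close> is fixed, and for \<open>q > sqrt X\<close> this determines the integer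
  \<open>m * p\<^sup>2\<close>, which leaves only \<open>O(L)\<close> choices of \<open>p\<close>. The \<open>d\<close> without such a prime factor
  are sparse by a sieve bound. The resulting error
  \<open>O(X powr (1/3) * L powr (-1/6) + X / (q * L))\<close> does not depend on \<open>\<gamma>\<close>.
\<close>

subsection \<open>Chebyshev-type bounds for primes\<close>

lemma prod_primes_dvd:
  fixes n :: "'a :: factorial_semiring_gcd"
  assumes "finite A" "\<And>p. p \<in> A \<Longrightarrow> prime p" "\<And>p. p \<in> A \<Longrightarrow> p dvd n"
  shows "\<Prod>A dvd n"
  using assms
proof (induction A rule: finite_induct)
  case (insert p A)
  have "coprime p (\<Prod>A)"
    using insert by (intro prod_coprime_right) (auto intro!: primes_coprime)
  with insert show ?case by (auto intro: divides_mult)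
qed auto

lemma prime_dvd_choose:
  fixes p n k :: nat
  assumes "prime p" "k < p" "n - k < p" "p \<le> n"
  shows "p dvd (n choose k)"
proof -
  have "fact k * fact (n - k) * (n choose k) = (fact n :: nat)"
    using assms by (intro binomial_fact_lemma) simp
  moreover have "p dvd fact n" "\<not> p dvd fact k" "\<not> p dvd fact (n - k)"
    using assms by (simp_all add: prime_dvd_fact_iff)
  ultimately show ?thesis
    using assms(1) by (metis prime_dvd_mult_iff)
qed

lemma choose_odd_middle_le: "((2 * m + 1) choose m) \<le> 4 ^ m"
proof -
  have "2 * ((2 * m + 1) choose m) = (\<Sum>k\<in>{m, Suc m}. (2 * m + 1) choose k)"
    using central_binomial_odd[of "2 * m + 1"] by simp
  also have "\<dots> \<le> (\<Sum>k\<le>2 * m + 1. (2 * m + 1) choose k)"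
    by (rule sum_mono2) auto
  also have "\<dots> = 2 ^ (2 * m + 1)" by (rule choose_row_sum)
  finally show ?thesis by (simp add: power_mult)
qed

lemma prod_primes_upper_half_le: "\<Prod>{p. prime p \<and> Suc m < p \<and> p \<le> 2 * m + 1} \<le> (4::nat) ^ m"
proof -
  have "finite {p. prime p \<and> Suc m < p \<and> p \<le> 2 * m + 1}"
    by (rule finite_subset[of _ "{..2 * m + 1}"]) auto
  then have "\<Prod>{p. prime p \<and> Suc m < p \<and> p \<le> 2 * m + 1} dvd ((2 * m + 1) choose m)"
    by (rule prod_primes_dvd) (auto intro: prime_dvd_choose)
  then have "\<Prod>{p. prime p \<and> Suc m < p \<and> p \<le> 2 * m + 1} \<le> ((2 * m + 1) choose m)"
    by (rule dvd_imp_le) simp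
  also have "\<dots> \<le> 4 ^ m" by (rule choose_odd_middle_le)
  finally show ?thesis .
qed

lemma primorial_le: "\<Prod>{p. prime p \<and> p \<le> n} \<le> (4::nat) ^ n"
proof (induction n rule: less_induct)
  case (less n)
  consider (small) "n \<le> 2" | (even) "n > 2" "even n" | (odd) m where "n = 2 * m + 1" "m \<ge> 1"
    by atomize_elim presburger
  then show ?case
  proof cases
    case small
    then have "{p. prime p \<and> p \<le> n} = (if n = 2 then {2} else {})"
      by (auto dest: prime_ge_2_nat intro: order_antisym)
    then show ?thesis by (simp only:) simp
  next
    case even
    then have "\<not> prime n" using prime_odd_nat by blast
    then have "prime p \<and> p \<le> n \<longleftrightarrow> prime p \<and> p \<le> n - 1" for p
      by (cases "p = n") auto
    then have "\<Prod>{p. prime p \<and> p \<le> n} = \<Prod>{p. prime p \<and> p \<le> n - 1}" by (simp only:)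
    also have "\<dots> \<le> 4 ^ (n - 1)" using even by (intro less) simp
    also have "\<dots> \<le> 4 ^ n" by (rule power_increasing) auto
    finally show ?thesis .
  next
    case (odd m)
    let ?lower = "{p. prime p \<and> p \<le> Suc m}" and ?upper = "{p. prime p \<and> Suc m < p \<and> p \<le> 2 * m + 1}"
    have "{p. prime p \<and> p \<le> n} = ?lower \<union> ?upper" using odd by auto
    moreover have "finite ?lower" "finite ?upper"
      by (auto intro: finite_subset[of _ "{..2 * m + 1}"])
    ultimately have "\<Prod>{p. prime p \<and> p \<le> n} = \<Prod>?lower * \<Prod>?upper"
      by (simp only:) (rule prod.union_disjoint; auto)
    also have "\<dots> \<le> 4 ^ Suc m * 4 ^ m"
      using odd by (intro mult_le_mono less prod_primes_upper_half_le) simp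
    also have "\<dots> = 4 ^ n" using odd by (simp flip: power_add add: mult_2)
    finally show ?thesis .
  qed
qed

definition primes_between :: "real \<Rightarrow> real \<Rightarrow> nat set" where
  "primes_between u v = {p. prime p \<and> u < real p \<and> real p \<le> v}"

lemma finite_primes_between [simp]: "finite (primes_between u v)"
  by (rule finite_subset[of _ "{..nat \<lfloor>v\<rfloor>}"]) (auto simp: primes_between_def le_nat_floor)

lemma prime_primes_between: "p \<in> primes_between u v \<Longrightarrow> prime p"
  by (simp add: primes_between_def)

lemma primes_between_mono: "u' \<le> u \<Longrightarrow> v \<le> v' \<Longrightarrow> primes_between u v \<subseteq> primes_between u' v'"
  by (auto simp: primes_between_def)

lemma primes_between_Un:
  assumes "u \<le> v" "v \<le> w"
  shows "primes_between u w = primes_between u v \<union> primes_between v w"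
  using assms by (auto simp: primes_between_def)

lemma primes_between_disjoint: "v \<le> v' \<Longrightarrow> primes_between u v \<inter> primes_between v' w = {}"
  by (auto simp: primes_between_def)

definition chebyshev_theta :: "real \<Rightarrow> real" where
  "chebyshev_theta x = (\<Sum>p\<in>primes_between 0 x. ln (real p))"

lemma chebyshev_theta_le:
  assumes "x \<ge> 0"
  shows "chebyshev_theta x \<le> ln 4 * x"
proof -
  define n where "n = nat \<lfloor>x\<rfloor>"
  have "primes_between 0 x = {p. prime p \<and> p \<le> n}"
    using assms by (auto simp: primes_between_def n_def le_nat_iff le_floor_iff prime_gt_0_nat)
  then have "chebyshev_theta x = ln (\<Prod>p | prime p \<and> p \<le> n. real p)"
    unfolding chebyshev_theta_def by (subst ln_prod) (auto simp: prime_gt_0_nat)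
  also have "\<dots> \<le> ln (real (4 ^ n))"
    using primorial_le[of n]
    by (intro ln_mono) (simp_all add: prime_gt_0_nat prod_pos flip: of_nat_prod)
  also have "\<dots> = ln 4 * real n" by (simp add: ln_realpow)
  also have "\<dots> \<le> ln 4 * x" using assms unfolding n_def by (intro mult_left_mono) auto
  finally show ?thesis .
qed

lemma sum_inverse_primes_double_le:
  assumes "v > 1"
  shows "(\<Sum>p\<in>primes_between v (2 * v). 1 / real p) \<le> 2 * ln 4 / ln v"
proof -
  have "(\<Sum>p\<in>primes_between v (2 * v). 1 / real p) \<le>
      (\<Sum>p\<in>primes_between v (2 * v). ln (real p) / (v * ln v))"
  proof (rule sum_mono)
    fix p assume p: "p \<in> primes_between v (2 * v)"
    then have "v * ln v \<le> real p * ln (real p)"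
      using assms by (intro mult_mono) (auto simp: primes_between_def)
    then show "1 / real p \<le> ln (real p) / (v * ln v)"
      using p assms by (simp add: field_simps primes_between_def)
  qed
  also have "\<dots> = (\<Sum>p\<in>primes_between v (2 * v). ln (real p)) / (v * ln v)"
    by (simp add: sum_divide_distrib)
  also have "\<dots> \<le> chebyshev_theta (2 * v) / (v * ln v)"
    unfolding chebyshev_theta_def using assms
    by (intro divide_right_mono sum_mono2 primes_between_mono)
      (auto dest!: prime_primes_between prime_gt_0_nat)
  also have "\<dots> \<le> ln 4 * (2 * v) / (v * ln v)"
    using assms by (intro divide_right_mono chebyshev_theta_le) auto
  also have "\<dots> = 2 * ln 4 / ln v" using assms by simp
  finally show ?thesis .
qed

lemma sum_inverse_primes_dyadic_le:
  assumes "u > 1"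
  shows "(\<Sum>p\<in>primes_between u (2 ^ j * u). 1 / real p) \<le> real j * (2 * ln 4 / ln u)"
proof (induction j)
  case 0
  have "primes_between u (2 ^ 0 * u) = {}" by (auto simp: primes_between_def)
  then show ?case by simp
next
  case (Suc j)
  define v where "v = 2 ^ j * u"
  have v: "u \<le> v" using assms unfolding v_def by (simp add: mult_le_cancel_right1)
  have "(\<Sum>p\<in>primes_between v (2 * v). 1 / real p) \<le> 2 * ln 4 / ln v"
    using assms v by (intro sum_inverse_primes_double_le) simp
  also have "\<dots> \<le> 2 * ln 4 / ln u" using assms v by (intro divide_left_mono) auto
  finally have double: "(\<Sum>p\<in>primes_between v (2 * v). 1 / real p) \<le> 2 * ln 4 / ln u" .
  have "primes_between u (2 ^ Suc j * u) = primes_between u v \<union> primes_between v (2 * v)"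
    using primes_between_Un[of u v "2 * v"] assms v by (simp add: v_def mult.assoc)
  then have "(\<Sum>p\<in>primes_between u (2 ^ Suc j * u). 1 / real p) =
      (\<Sum>p\<in>primes_between u v. 1 / real p) + (\<Sum>p\<in>primes_between v (2 * v). 1 / real p)"
    by (simp only:) (rule sum.union_disjoint; simp add: primes_between_disjoint)
  also have "\<dots> \<le> real j * (2 * ln 4 / ln u) + 2 * ln 4 / ln u"
    using Suc double unfolding v_def by (rule add_mono)
  also have "\<dots> = real (Suc j) * (2 * ln 4 / ln u)"
    by (simp add: add_divide_distrib distrib_right)
  finally show ?case .
qed

lemma sum_inverse_primes_between_le:
  assumes "u > 1" "u \<le> v"
  shows "(\<Sum>p\<in>primes_between u v. 1 / real p) \<le> 4 * ln (2 * v / u) / ln u"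
proof -
  define j where "j = nat \<lceil>log 2 (v / u)\<rceil>"
  have "0 \<le> log 2 (v / u)" using assms by simp
  then have j: "log 2 (v / u) \<le> real j" "real j \<le> log 2 (v / u) + 1"
    unfolding j_def by linarith+
  then have "v / u \<le> 2 powr real j" using assms by (simp add: log_le_iff)
  then have "v \<le> 2 ^ j * u" using assms by (simp add: powr_realpow field_simps)
  then have "(\<Sum>p\<in>primes_between u v. 1 / real p) \<le> (\<Sum>p\<in>primes_between u (2 ^ j * u). 1 / real p)"
    by (intro sum_mono2 primes_between_mono) auto
  also have "\<dots> \<le> real j * (2 * ln 4 / ln u)" by (rule sum_inverse_primes_dyadic_le) fact
  also have "\<dots> \<le> log 2 (2 * v / u) * (2 * ln 4 / ln u)"
    using assms j by (intro mult_right_mono) (auto simp: log_mult simp flip: times_divide_eq_right)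
  also have "ln 4 = 2 * ln (2 :: real)" using ln_realpow[of 2 2] by simp
  finally show ?thesis by (simp add: log_def mult.commute)
qed

lemma prod_odd_le_sqrt: "(\<Prod>k=1..K. 1 + 1 / real (2 * k + 1)) \<le> sqrt (real K + 1)"
proof (induction K)
  case (Suc K)
  have "(1 + 1 / real (2 * Suc K + 1))\<^sup>2 * (real K + 1) \<le> real (Suc K) + 1"
    by (simp add: divide_simps power2_eq_square) (simp add: algebra_simps)
  then have "sqrt (real K + 1) * (1 + 1 / real (2 * Suc K + 1)) \<le> sqrt (real (Suc K) + 1)"
    by (intro real_le_rsqrt) (simp add: power_mult_distrib mult.commute)
  moreover have "(\<Prod>k=1..Suc K. 1 + 1 / real (2 * k + 1)) \<le>
      sqrt (real K + 1) * (1 + 1 / real (2 * Suc K + 1))"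
    using mult_right_mono[OF Suc, of "1 + 1 / real (2 * Suc K + 1)"] by simp
  ultimately show ?case by linarith
qed auto

text \<open>Mertens would give a multiple of \<open>ln y\<close>; discarding only the even numbers is enough here.\<close>

lemma prod_one_plus_inverse_primes_le:
  assumes "y \<ge> 1"
  shows "(\<Prod>p\<in>primes_between 0 y. 1 + 1 / real p) \<le> 2 * sqrt y"
proof -
  define K where "K = nat \<lfloor>y\<rfloor> div 2"
  have "primes_between 0 y \<subseteq> insert 2 ((\<lambda>k. 2 * k + 1) ` {1..K})"
  proof
    fix p assume "p \<in> primes_between 0 y"
    then have p: "prime p" "p \<le> nat \<lfloor>y\<rfloor>" by (simp_all add: primes_between_def le_nat_floor)
    show "p \<in> insert 2 ((\<lambda>k. 2 * k + 1) ` {1..K})"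
    proof (cases "p = 2")
      case False
      with p have "odd p" "p > 2" using prime_odd_nat[of p] prime_ge_2_nat[of p] by auto
      then obtain k where "p = 2 * k + 1" by (auto elim: oddE)
      with p \<open>p > 2\<close> show ?thesis unfolding K_def by auto
    qed auto
  qed
  then have "(\<Prod>p\<in>primes_between 0 y. 1 + 1 / real p) \<le>
      (\<Prod>p\<in>insert 2 ((\<lambda>k. 2 * k + 1) ` {1..K}). 1 + 1 / real p)"
    by (intro prod_mono2) auto
  also have "\<dots> = (1 + 1 / 2) * (\<Prod>k=1..K. 1 + 1 / real (2 * k + 1))"
    by (subst prod.insert) (auto simp: prod.reindex inj_on_def)
  also have "\<dots> \<le> 3 / 2 * sqrt (real K + 1)" using prod_odd_le_sqrt[of K] by simp
  also have "\<dots> = sqrt ((3 / 2)\<^sup>2 * (real K + 1))" by (simp add: real_sqrt_mult)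
  also have "\<dots> \<le> sqrt (2\<^sup>2 * y)"
  proof (rule real_sqrt_le_mono)
    have "2 * real K \<le> y" using assms unfolding K_def by linarith
    then show "(3 / 2)\<^sup>2 * (real K + 1) \<le> 2\<^sup>2 * y" using assms by (simp add: power2_eq_square)
  qed
  finally show ?thesis by (simp add: real_sqrt_mult)
qed

subsection \<open>Squarefree numbers with prescribed prime factors\<close>

definition squarefree_over :: "nat set \<Rightarrow> nat set" where
  "squarefree_over P = {d. squarefree d \<and> prime_factors d \<subseteq> P}"

lemma prime_factors_prod_primes:
  fixes S :: "'a :: factorial_semiring set"
  assumes "finite S" "\<And>p. p \<in> S \<Longrightarrow> prime p"
  shows "prime_factors (\<Prod>S) = S"
proof -
  have "0 \<notin> S" using assms(2) not_prime_0 by blast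
  then have "prime_factors (\<Prod>S) = (\<Union>p\<in>S. prime_factors p)"
    using assms(1) by (subst prime_factors_prod) auto
  also have "\<dots> = S" using assms(2) by (simp add: prime_prime_factors)
  finally show ?thesis .
qed

lemma squarefree_prod_primes:
  fixes S :: "'a :: factorial_semiring_gcd set"
  assumes "\<And>p. p \<in> S \<Longrightarrow> prime p"
  shows "squarefree (\<Prod>S)"
  using assms by (intro squarefree_prod_coprime) (auto intro: primes_coprime squarefree_prime)

lemma prod_prime_factors_squarefree:
  fixes d :: nat
  assumes "squarefree d"
  shows "\<Prod>(prime_factors d) = d"
proof -
  have d: "d \<noteq> 0" using assms by (intro notI) auto
  then have "multiplicity p d = 1" if "p \<in> prime_factors d" for p
    using assms that by (auto simp: squarefree_factorial_semiring' prime_factors_multiplicity)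
  then have "\<Prod>(prime_factors d) = (\<Prod>p\<in>prime_factors d. p ^ multiplicity p d)" by simp
  also have "\<dots> = d" using d by (simp add: prime_factorization_nat[symmetric])
  finally show ?thesis .
qed

lemma bij_betw_prod_squarefree_over:
  assumes "finite P" "\<And>p. p \<in> P \<Longrightarrow> prime p"
  shows "bij_betw Prod (Pow P) (squarefree_over P)"
proof (rule bij_betw_byWitness[where f' = prime_factors])
  have "prime_factors (\<Prod>S) = S \<and> squarefree (\<Prod>S)" if "S \<subseteq> P" for S
    using that assms finite_subset[OF that]
    by (auto intro!: prime_factors_prod_primes squarefree_prod_primes)
  then show "\<forall>S\<in>Pow P. prime_factors (\<Prod>S) = S" "Prod ` Pow P \<subseteq> squarefree_over P"
    by (auto simp: squarefree_over_def)
qed (auto simp: squarefree_over_def prod_prime_factors_squarefree)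

lemma finite_squarefree_over:
  assumes "finite P" "\<And>p. p \<in> P \<Longrightarrow> prime p"
  shows "finite (squarefree_over P)"
  using bij_betw_finite[OF bij_betw_prod_squarefree_over[OF assms]] assms(1) by simp

lemma sum_squarefree_over:
  fixes f :: "nat \<Rightarrow> 'a :: comm_semiring_1"
  assumes "finite P" "\<And>p. p \<in> P \<Longrightarrow> prime p"
  shows "(\<Sum>d\<in>squarefree_over P. \<Prod>p\<in>prime_factors d. f p) = (\<Prod>p\<in>P. f p + 1)"
proof -
  have "(\<Sum>d\<in>squarefree_over P. \<Prod>p\<in>prime_factors d. f p) = (\<Sum>S\<in>Pow P. \<Prod>p\<in>prime_factors (\<Prod>S). f p)"
    by (rule sum.reindex_bij_betw[OF bij_betw_prod_squarefree_over[OF assms], symmetric])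
  also have "\<dots> = (\<Sum>S\<in>Pow P. prod f S)"
    by (intro sum.cong refl arg_cong[where f = "prod f"] prime_factors_prod_primes)
      (use assms finite_subset in auto)
  also have "\<dots> = (\<Prod>p\<in>P. f p + 1)" by (simp add: prod_add assms(1))
  finally show ?thesis .
qed

lemma sum_inverse_squarefree_over:
  assumes "finite P" "\<And>p. p \<in> P \<Longrightarrow> prime p"
  shows "(\<Sum>d\<in>squarefree_over P. 1 / real d) = (\<Prod>p\<in>P. 1 + 1 / real p)"
proof -
  have "1 / real d = (\<Prod>p\<in>prime_factors d. 1 / real p)" if "d \<in> squarefree_over P" for d
    using that prod_prime_factors_squarefree[of d]
    by (simp add: squarefree_over_def prod_dividef flip: of_nat_prod)
  then have "(\<Sum>d\<in>squarefree_over P. 1 / real d) =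
      (\<Sum>d\<in>squarefree_over P. \<Prod>p\<in>prime_factors d. 1 / real p)"
    by (rule sum.cong[OF refl])
  also have "\<dots> = (\<Prod>p\<in>P. 1 + 1 / real p)"
    using sum_squarefree_over[OF assms, of "\<lambda>p. 1 / real p"] by (simp add: add.commute)
  finally show ?thesis .
qed

lemma ln_squarefree_eq_sum:
  fixes d :: nat
  assumes "squarefree d"
  shows "ln (real d) = (\<Sum>p\<in>prime_factors d. ln (real p))"
proof -
  have "ln (real d) = ln (\<Prod>p\<in>prime_factors d. real p)"
    using prod_prime_factors_squarefree[OF assms] by (simp flip: of_nat_prod)
  also have "\<dots> = (\<Sum>p\<in>prime_factors d. ln (real p))"
    by (rule ln_prod) (auto intro: prime_gt_0_nat)
  finally show ?thesis .
qed

lemma squarefree_over_divide_primeE: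
  assumes "d \<in> squarefree_over P" "p \<in> prime_factors d"
  obtains m where "d = p * m" "m > 0" "m \<in> squarefree_over P"
proof -
  obtain m where m: "d = p * m" using assms(2) by auto
  have d: "d \<noteq> 0" using assms(2) by (intro notI) auto
  then have "prime_factors m \<subseteq> prime_factors d" using m by (intro dvd_prime_factors) auto
  moreover have "squarefree m"
    using assms(1) m by (auto simp: squarefree_over_def dest: squarefree_multD)
  ultimately show thesis using that[of m] assms(1) m d by (auto simp: squarefree_over_def)
qed

text \<open>Writing \<open>ln d\<close> as a sum over the prime factors \<open>p\<close> of \<open>d\<close> and summing over \<open>p\<close> first,
  for fixed \<open>m = d div p\<close>, brings in the Chebyshev bound.\<close>

lemma sum_ln_squarefree_over_le:
  assumes "finite P" "\<And>p. p \<in> P \<Longrightarrow> prime p" "x \<ge> 0"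
  shows "(\<Sum>d | d \<in> squarefree_over P \<and> real d \<le> x. ln (real d)) \<le> ln 4 * x * (\<Prod>p\<in>P. 1 + 1 / real p)"
proof -
  let ?S = "squarefree_over P" and ?T = "{d. d \<in> squarefree_over P \<and> real d \<le> x}"
  let ?cofactors = "Sigma ?S (\<lambda>m. primes_between 0 (x / real m))"
  have fin: "finite ?S" "finite ?T" using finite_squarefree_over[OF assms(1,2)] by auto
  have "(\<Sum>d\<in>?T. ln (real d)) = (\<Sum>d\<in>?T. \<Sum>p\<in>prime_factors d. ln (real p))"
    by (intro sum.cong refl ln_squarefree_eq_sum) (auto simp: squarefree_over_def)
  also have "\<dots> = (\<Sum>(d, p)\<in>Sigma ?T prime_factors. ln (real p))"
    using fin by (intro sum.Sigma) auto
  also have "\<dots> \<le> (\<Sum>(m, p)\<in>?cofactors. ln (real p))"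
  proof (rule sum_le_included[where i = "\<lambda>(m, p). (p * m, p)"])
    show "\<forall>y\<in>Sigma ?T prime_factors. \<exists>z\<in>?cofactors. (case z of (m, p) \<Rightarrow> (p * m, p)) = y \<and>
        (case y of (d, p) \<Rightarrow> ln (real p)) \<le> (case z of (m, p) \<Rightarrow> ln (real p))"
    proof clarify
      fix d p assume d: "d \<in> ?S" "real d \<le> x" and p: "p \<in> prime_factors d"
      obtain m where m: "d = p * m" "m > 0" "m \<in> ?S"
        using squarefree_over_divide_primeE[OF d(1) p] by blast
      then have "p \<in> primes_between 0 (x / real m)"
        using d p by (auto simp: primes_between_def field_simps intro!: prime_gt_0_nat)
      then show "\<exists>z\<in>?cofactors. (case z of (m, p) \<Rightarrow> (p * m, p)) = (d, p) \<and>
          ln (real p) \<le> (case z of (m, p) \<Rightarrow> ln (real p))"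
        using m by (intro bexI[of _ "(m, p)"]) auto
    qed
  qed (use fin in \<open>auto intro!: finite_SigmaI dest!: prime_primes_between prime_gt_0_nat\<close>)
  also have "\<dots> = (\<Sum>m\<in>?S. chebyshev_theta (x / real m))"
    unfolding chebyshev_theta_def using fin by (intro sum.Sigma[symmetric]) auto
  also have "\<dots> \<le> (\<Sum>m\<in>?S. ln 4 * (x / real m))"
    using assms(3) by (intro sum_mono chebyshev_theta_le) auto
  also have "\<dots> = ln 4 * x * (\<Sum>m\<in>?S. 1 / real m)" by (simp add: sum_distrib_left)
  finally show ?thesis by (simp only: sum_inverse_squarefree_over[OF assms(1,2)])
qed

lemma card_squarefree_over_between_le:
  assumes "finite P" "\<And>p. p \<in> P \<Longrightarrow> prime p" "u > 1" "v \<ge> 0"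
  shows "real (card {d\<in>squarefree_over P. u < real d \<and> real d \<le> v}) \<le>
    ln 4 * v / ln u * (\<Prod>p\<in>P. 1 + 1 / real p)"
proof -
  let ?T = "{d. d \<in> squarefree_over P \<and> real d \<le> v}"
  let ?U = "{d\<in>squarefree_over P. u < real d \<and> real d \<le> v}"
  have "real (card ?U) * ln u = (\<Sum>d\<in>?U. ln u)" by simp
  also have "\<dots> \<le> (\<Sum>d\<in>?U. ln (real d))" using assms by (intro sum_mono) auto
  also have "\<dots> \<le> (\<Sum>d\<in>?T. ln (real d))"
  proof (rule sum_mono2)
    show "finite ?T" using finite_squarefree_over[OF assms(1,2)] by simp
    fix d assume "d \<in> ?T - ?U"
    then have "d \<noteq> 0" by (intro notI) (auto simp: squarefree_over_def)
    then show "0 \<le> ln (real d)" by simp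
  qed auto
  also have "\<dots> \<le> ln 4 * v * (\<Prod>p\<in>P. 1 + 1 / real p)"
    by (rule sum_ln_squarefree_over_le) fact+
  finally show ?thesis using assms(3) by (simp add: pos_le_divide_eq)
qed

subsection \<open>The Moebius function\<close>

lemma moebius_mu_square: "(moebius_mu n)\<^sup>2 = of_bool (squarefree n)"
  by (simp add: moebius_mu_def flip: power_mult)

lemma abs_moebius_mu: "\<bar>moebius_mu n\<bar> = of_bool (squarefree n)"
  by (simp add: moebius_mu_def power_abs)

lemma squarefree_over_prime_factors:
  assumes "n > 0"
  shows "squarefree_over (prime_factors n) = {d. squarefree d \<and> d dvd n}"
proof (intro equalityI subsetI)
  fix d assume "d \<in> squarefree_over (prime_factors n)"
  then have d: "squarefree d" "prime_factors d \<subseteq> prime_factors n"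
    by (auto simp: squarefree_over_def)
  then have "\<Prod>(prime_factors d) dvd n" by (intro prod_primes_dvd) auto
  with d show "d \<in> {d. squarefree d \<and> d dvd n}" by (simp add: prod_prime_factors_squarefree)
next
  fix d assume "d \<in> {d. squarefree d \<and> d dvd n}"
  then show "d \<in> squarefree_over (prime_factors n)"
    using assms by (simp add: squarefree_over_def dvd_prime_factors)
qed

lemma sum_moebius_mu_dvd:
  assumes "n > 0"
  shows "(\<Sum>d | d dvd n. moebius_mu d) = of_bool (n = 1)"
proof -
  have "(\<Sum>d | d dvd n. moebius_mu d) = (\<Sum>d | squarefree d \<and> d dvd n. moebius_mu d)"
    using assms by (intro sum.mono_neutral_right) (auto simp: moebius_mu_def)
  also have "\<dots> = (\<Sum>d\<in>squarefree_over (prime_factors n). moebius_mu d)"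
    by (simp only: squarefree_over_prime_factors[OF assms])
  also have "\<dots> = (\<Sum>d\<in>squarefree_over (prime_factors n). \<Prod>p\<in>prime_factors d. - 1)"
    by (intro sum.cong refl) (simp add: squarefree_over_def moebius_mu_def)
  also have "\<dots> = (\<Prod>p\<in>prime_factors n. - 1 + 1)" by (rule sum_squarefree_over) auto
  also have "\<dots> = of_bool (prime_factors n = {})" by (simp add: card_gt_0_iff)
  also have "prime_factors n = {} \<longleftrightarrow> n = 1" using assms by (simp add: prime_factorization_empty_iff)
  finally show ?thesis .
qed

lemma sum_moebius_mu_square_dvd:
  assumes "n > 0"
  shows "(\<Sum>d | d\<^sup>2 dvd n. moebius_mu d) = (moebius_mu n)\<^sup>2"
proof -
  have "(\<Sum>d | d\<^sup>2 dvd n. moebius_mu d) = (\<Sum>d | d dvd square_part n. moebius_mu d)"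
    by (simp only: dvd_square_part_iff)
  also have "\<dots> = of_bool (square_part n = 1)"
    using assms by (intro sum_moebius_mu_dvd Nat.gr0I) simp
  also have "square_part n = 1 \<longleftrightarrow> squarefree n"
  proof
    assume "square_part n = 1"
    then show "squarefree n" by (intro squarefreeI) (simp flip: dvd_square_part_iff)
  next
    assume "squarefree n"
    then show "square_part n = 1" using squarefreeD[of n "square_part n"] by simp
  qed
  finally show ?thesis by (simp only: moebius_mu_square)
qed

lemma sum_moebius_mu_square_eq:
  assumes "S \<subseteq> {1..N}"
  shows "(\<Sum>n\<in>S. (moebius_mu n)\<^sup>2) = (\<Sum>d\<in>{1..N}. moebius_mu d * int (card {n\<in>S. d\<^sup>2 dvd n}))"
proof -
  have fin: "finite S" using assms finite_subset by blast
  have "(\<Sum>d | d \<in> {1..N} \<and> d\<^sup>2 dvd n. moebius_mu d) = (moebius_mu n)\<^sup>2" if "n \<in> S" for n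
  proof -
    have n: "0 < n" "n \<le> N" using assms that by auto
    have "d \<in> {1..N}" if "d\<^sup>2 dvd n" for d
    proof -
      have "d dvd n" using that by (rule dvd_trans[rotated]) simp
      then have "d \<le> n" "d > 0" using n(1) dvd_imp_le dvd_pos_nat by blast+
      then show ?thesis using n(2) by simp
    qed
    then have "{d. d \<in> {1..N} \<and> d\<^sup>2 dvd n} = {d. d\<^sup>2 dvd n}" by blast
    then show ?thesis by (simp only: sum_moebius_mu_square_dvd[OF n(1)])
  qed
  then have "(\<Sum>n\<in>S. (moebius_mu n)\<^sup>2) = (\<Sum>n\<in>S. \<Sum>d | d \<in> {1..N} \<and> d\<^sup>2 dvd n. moebius_mu d)"
    by (intro sum.cong refl) (simp only:)
  also have "\<dots> = (\<Sum>d\<in>{1..N}. \<Sum>n | n \<in> S \<and> d\<^sup>2 dvd n. moebius_mu d)"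
    using fin by (intro sum.swap_restrict) auto
  also have "\<dots> = (\<Sum>d\<in>{1..N}. moebius_mu d * int (card {n\<in>S. d\<^sup>2 dvd n}))"
    by (simp add: mult.commute)
  finally show ?thesis .
qed

subsection \<open>Multiples in residue classes\<close>

lemma card_cong_bounds:
  fixes N k :: nat and c :: int
  assumes "k > 0"
  shows "N div k \<le> card {n\<in>{1..N}. [int n = c] (mod int k)}"
    and "card {n\<in>{1..N}. [int n = c] (mod int k)} \<le> N div k + 1"
proof -
  let ?A = "{n\<in>{1..N}. [int n = c] (mod int k)}" and ?block = "\<lambda>n. (n - 1) div k"
  have "inj_on ?block ?A"
  proof (rule inj_onI)
    fix m n assume "m \<in> ?A" "n \<in> ?A" and block: "?block m = ?block n"
    then have cong: "[int m = c] (mod int k)" "[int n = c] (mod int k)" and pos: "m \<ge> 1" "n \<ge> 1"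
      by simp_all
    have "[int m = int n] (mod int k)" using cong_trans[OF cong(1) cong_sym[OF cong(2)]] .
    with pos have "[Suc (m - 1) = Suc (n - 1)] (mod k)" by (simp add: cong_int_iff)
    then have "[m - 1 = n - 1] (mod k)" by (simp only: Suc_eq_plus1 cong_add_rcancel_nat)
    then have "(m - 1) mod k = (n - 1) mod k"
      by (simp only: unique_euclidean_semiring_class.cong_def)
    then have "(m - 1) div k * k + (m - 1) mod k = (n - 1) div k * k + (n - 1) mod k"
      using block by (simp only:)
    then show "m = n" using pos by simp
  qed
  then have "card ?A = card (?block ` ?A)" by (simp add: card_image)
  moreover have "{..<N div k} \<subseteq> ?block ` ?A"
  proof
    fix j assume "j \<in> {..<N div k}"
    define r where "r = nat ((c - 1) mod int k)"
    have r: "r < k" "int r = (c - 1) mod int k" using assms by (auto simp: r_def nat_less_iff)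
    have "Suc j * k \<le> N div k * k" using \<open>j \<in> _\<close> by (intro mult_le_mono1) simp
    also have "\<dots> \<le> N" by (rule div_times_less_eq_dividend)
    finally have "j * k + k \<le> N" by simp
    moreover have "[int (j * k + r) + 1 = (c - 1) + 1] (mod int k)"
      by (intro cong_add cong_refl) (simp add: r unique_euclidean_semiring_class.cong_def)
    ultimately have "j * k + r + 1 \<in> ?A" using r(1) by (simp add: add_ac)
    moreover have "j = ?block (j * k + r + 1)" using r(1) by simp
    ultimately show "j \<in> ?block ` ?A" by (rule rev_image_eqI)
  qed
  moreover have "?block ` ?A \<subseteq> {..N div k}" by (auto intro: div_le_mono)
  ultimately show "N div k \<le> card ?A" "card ?A \<le> N div k + 1"
    using card_mono[of "?block ` ?A" "{..<N div k}"] card_mono[of "{..N div k}" "?block ` ?A"]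
    by simp_all
qed

lemma card_multiples:
  assumes "k > (0::nat)"
  shows "card {n\<in>{1..N}. k dvd n} = N div k"
proof -
  have "{n\<in>{1..N}. k dvd n} = (*) k ` {1..N div k}"
    using assms
    by (auto simp: less_eq_div_iff_mult_less_eq mult.commute elim!: dvdE intro!: image_eqI)
  then show ?thesis using assms by (simp add: card_image inj_on_def)
qed

definition multiples_cong :: "nat \<Rightarrow> nat \<Rightarrow> int \<Rightarrow> nat \<Rightarrow> nat set" where
  "multiples_cong N q a k = {n\<in>{1..N}. k dvd n \<and> [int n = a] (mod int q)}"

definition multiples_coprime :: "nat \<Rightarrow> nat \<Rightarrow> nat \<Rightarrow> nat set" where
  "multiples_coprime N q k = {n\<in>{1..N}. k dvd n \<and> coprime n q}"

lemma finite_multiples_cong [simp]: "finite (multiples_cong N q a k)"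
  by (simp add: multiples_cong_def)

lemma multiples_coprime_eq_empty: "\<not> coprime k q \<Longrightarrow> multiples_coprime N q k = {}"
  by (auto simp: multiples_coprime_def dest: coprime_divisors[OF _ dvd_refl])

lemma multiples_cong_subset_coprime:
  assumes "coprime a (int q)"
  shows "multiples_cong N q a k \<subseteq> multiples_coprime N q k"
proof
  fix n assume n: "n \<in> multiples_cong N q a k"
  then have "[a = int n] (mod int q)" by (simp add: multiples_cong_def cong_sym)
  then have "coprime (int n) (int q)" using assms cong_imp_coprime by blast
  with n show "n \<in> multiples_coprime N q k" by (simp add: multiples_cong_def multiples_coprime_def)
qed

lemma card_multiples_cong_bounds:
  assumes "coprime k q" "k > 0" "q > 0"
  shows "N div (k * q) \<le> card (multiples_cong N q a k)"
    and "card (multiples_cong N q a k) \<le> N div (k * q) + 1"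
proof -
  have cop: "coprime (int k) (int q)" using assms by simp
  then obtain c where c: "[c = 0] (mod int k)" "[c = a] (mod int q)"
    using binary_chinese_remainder_int by blast
  have "k dvd n \<and> [int n = a] (mod int q) \<longleftrightarrow> [int n = c] (mod int (k * q))" for n
  proof -
    have "k dvd n \<longleftrightarrow> [int n = 0] (mod int k)" by (simp add: cong_0_iff)
    also have "\<dots> \<longleftrightarrow> [int n = c] (mod int k)" using c(1) cong_trans cong_sym by blast
    moreover have "[int n = a] (mod int q) \<longleftrightarrow> [int n = c] (mod int q)"
      using c(2) cong_trans cong_sym by blast
    ultimately show ?thesis
      using cop cong_modulus_mult[of "int n" c "int k" "int q"]
        cong_modulus_mult[of "int n" c "int q" "int k"]
      by (auto simp: mult.commute intro: coprime_cong_mult)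
  qed
  then show "N div (k * q) \<le> card (multiples_cong N q a k)"
    "card (multiples_cong N q a k) \<le> N div (k * q) + 1"
    unfolding multiples_cong_def using assms card_cong_bounds[of "k * q" N c] by simp_all
qed

lemma card_multiples_coprime:
  assumes "prime q" "coprime k q" "k > 0"
  shows "card (multiples_coprime N q k) = N div k - N div (k * q)"
proof -
  have q: "q > 0" using assms(1) prime_gt_0_nat by blast
  have "k * q dvd n \<longleftrightarrow> k dvd n \<and> q dvd n" for n
    using divides_mult[OF _ _ assms(2), of n] dvd_mult_left[of k q n] dvd_mult_right[of k q n]
    by auto
  moreover have "coprime n q \<longleftrightarrow> \<not> q dvd n" for n
    using assms(1) prime_imp_coprime[of q n] by (auto simp: coprime_commute)
  ultimately have "multiples_coprime N q k = {n\<in>{1..N}. k dvd n} - {n\<in>{1..N}. k * q dvd n}"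
    by (auto simp: multiples_coprime_def)
  then have "card (multiples_coprime N q k) = card ({n\<in>{1..N}. k dvd n} - {n\<in>{1..N}. k * q dvd n})"
    by (simp only:)
  also have "\<dots> = card {n\<in>{1..N}. k dvd n} - card {n\<in>{1..N}. k * q dvd n}"
    by (rule card_Diff_subset) (auto dest: dvd_mult_left[of k q])
  also have "\<dots> = N div k - N div (k * q)"
    using assms(3) q by (simp only: card_multiples mult_pos_pos)
  finally show ?thesis .
qed

definition discrepancy :: "nat \<Rightarrow> nat \<Rightarrow> int \<Rightarrow> nat \<Rightarrow> real" where
  "discrepancy N q a k =
     real (card (multiples_cong N q a k)) -
     real (card (multiples_coprime N q k)) / real (totient q)"

lemma abs_discrepancy_le_1:
  assumes "prime q" "coprime a (int q)" "k > 0"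
  shows "\<bar>discrepancy N q a k\<bar> \<le> 1"
proof (cases "coprime k q")
  case False
  then have "multiples_coprime N q k = {}" "multiples_cong N q a k = {}"
    using multiples_coprime_eq_empty multiples_cong_subset_coprime[OF assms(2)] by blast+
  then show ?thesis by (simp add: discrepancy_def)
next
  case True
  define M b where "M = N div k" and "b = M div q"
  have q: "real q > 1" using assms(1) prime_gt_1_nat by simp
  have b: "b = N div (k * q)" by (simp add: b_def M_def div_mult2_eq)
  have cong: "real b \<le> card (multiples_cong N q a k)" "card (multiples_cong N q a k) \<le> real b + 1"
    using card_multiples_cong_bounds[OF True assms(3), of N a] q by (simp_all add: b)
  have "b \<le> M" by (simp add: b_def)
  then have coprime: "real (card (multiples_coprime N q k)) = real M - real b"
    using card_multiples_coprime[OF assms(1) True assms(3), of N]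
    by (simp add: of_nat_diff flip: b M_def)
  have totient: "real (totient q) = real q - 1"
    using assms(1) q by (simp add: totient_prime of_nat_diff)
  have "M = b * q + M mod q" unfolding b_def by simp
  then have "real M = real b * real q + real (M mod q)" by (metis of_nat_add of_nat_mult)
  moreover have "real (M mod q) \<le> real q - 1"
  proof -
    have "M mod q < q" using q by simp
    then show ?thesis by linarith
  qed
  ultimately have "real b * (real q - 1) \<le> real M - real b"
    "real M - real b \<le> (real b + 1) * (real q - 1)"
    by (simp_all add: algebra_simps)
  then have "real b \<le> (real M - real b) / (real q - 1)"
    "(real M - real b) / (real q - 1) \<le> real b + 1"
    using q by (simp_all add: pos_le_divide_eq pos_divide_le_eq)
  then show ?thesis using cong unfolding discrepancy_def coprime totient by linarith
qed

lemma card_multiples_cong_le: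
  assumes "coprime a (int q)" "k > 0" "q > 0"
  shows "real (card (multiples_cong N q a k)) \<le>
    real N / (real k * real q) + of_bool (multiples_cong N q a k \<noteq> {})"
proof (cases "multiples_cong N q a k = {}")
  case False
  then have "coprime k q"
    using multiples_cong_subset_coprime[OF assms(1)] multiples_coprime_eq_empty by blast
  then have "card (multiples_cong N q a k) \<le> N div (k * q) + 1"
    using assms(2,3) by (rule card_multiples_cong_bounds(2))
  then have "real (card (multiples_cong N q a k)) \<le> real (N div (k * q)) + 1" by linarith
  also have "real (N div (k * q)) \<le> real N / real (k * q)" by (rule of_nat_div_le_of_nat)
  finally show ?thesis using False by simp
qed simp

lemma card_multiples_coprime_le:
  assumes "prime q" "k > 0"
  shows "real (card (multiples_coprime N q k)) / real (totient q) \<le>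
    2 * (real N / (real k * real q))"
proof -
  have q: "real q \<ge> 2" using prime_ge_2_nat[OF assms(1)] by simp
  have "card (multiples_coprime N q k) \<le> card {n\<in>{1..N}. k dvd n}"
    by (rule card_mono) (auto simp: multiples_coprime_def)
  also have "\<dots> = N div k" using assms(2) by (rule card_multiples)
  finally have "real (card (multiples_coprime N q k)) \<le> real (N div k)" by (rule of_nat_mono)
  also have "\<dots> \<le> real N / real k" by (rule of_nat_div_le_of_nat)
  finally have "real (card (multiples_coprime N q k)) \<le> real N / real k" .
  moreover have "real q / 2 \<le> real (totient q)"
    using assms(1) q by (simp add: totient_prime of_nat_diff)
  ultimately have "real (card (multiples_coprime N q k)) / real (totient q) \<le>
      (real N / real k) / (real q / 2)"
    using q by (intro frac_le) auto
  then show ?thesis by (simp add: mult.commute)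
qed

lemma sum_moebius_mu_square_upto:
  "(\<Sum>n | 0 < n \<and> real n \<le> X \<and> P n. real_of_int ((moebius_mu n)\<^sup>2)) =
    (\<Sum>d\<in>{1..nat \<lfloor>X\<rfloor>}. real_of_int (moebius_mu d) * real (card {n\<in>{1..nat \<lfloor>X\<rfloor>}. d\<^sup>2 dvd n \<and> P n}))"
proof -
  define N where "N = nat \<lfloor>X\<rfloor>"
  have "{n. 0 < n \<and> real n \<le> X \<and> P n} = {n\<in>{1..N}. P n}"
    by (auto simp: N_def le_nat_floor Suc_le_eq) linarith
  then have "(\<Sum>n | 0 < n \<and> real n \<le> X \<and> P n. real_of_int ((moebius_mu n)\<^sup>2)) =
      real_of_int (\<Sum>n\<in>{n\<in>{1..N}. P n}. (moebius_mu n)\<^sup>2)"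
    by simp
  also have "(\<Sum>n\<in>{n\<in>{1..N}. P n}. (moebius_mu n)\<^sup>2) =
      (\<Sum>d\<in>{1..N}. moebius_mu d * int (card {n\<in>{n\<in>{1..N}. P n}. d\<^sup>2 dvd n}))"
    by (rule sum_moebius_mu_square_eq) auto
  finally show ?thesis by (simp add: N_def conj_ac)
qed

lemma E_eq_sum_discrepancy:
  "E X q a = (\<Sum>d\<in>{1..nat \<lfloor>X\<rfloor>}. real_of_int (moebius_mu d) * discrepancy (nat \<lfloor>X\<rfloor>) q a (d\<^sup>2))"
  unfolding E_def sum_moebius_mu_square_upto discrepancy_def
    multiples_cong_def multiples_coprime_def
  by (simp add: sum_distrib_left sum_subtractf[symmetric] right_diff_distrib mult_ac)

subsection \<open>Contributions of small and large divisors\<close>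

lemma card_square_roots_le:
  assumes "prime q" "coprime a (int q)"
  shows "card {d\<in>{1..M}. [int (d\<^sup>2 * m) = a] (mod int q)} \<le> 2 * (M div q + 1)"
proof (cases "\<exists>e. [int (e\<^sup>2 * m) = a] (mod int q)")
  case True
  then obtain e where e: "[int (e\<^sup>2 * m) = a] (mod int q)" by blast
  let ?class = "\<lambda>c. {d\<in>{1..M}. [int d = c] (mod int q)}"
  have q: "prime (int q)" "q > 0" using assms(1) by (simp_all add: prime_gt_0_nat)
  have "coprime (int (e\<^sup>2 * m)) (int q)" using e assms(2) cong_imp_coprime cong_sym by blast
  then have "coprime (int q) (int m)" by (simp add: coprime_commute)
  then have "\<not> int q dvd int m" using q(1) by (metis coprime_absorb_left not_prime_unit)
  have "[int d = int e] (mod int q) \<or> [int d = - int e] (mod int q)"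
    if "[int (d\<^sup>2 * m) = a] (mod int q)" for d
  proof -
    have "[int (d\<^sup>2 * m) = int (e\<^sup>2 * m)] (mod int q)"
      using that cong_sym[OF e] by (rule cong_trans)
    then have "int q dvd (int d - int e) * (int d + int e) * int m"
      by (simp add: cong_iff_dvd_diff algebra_simps power2_eq_square)
    then have "int q dvd int d - int e \<or> int q dvd int d + int e"
      using \<open>\<not> int q dvd int m\<close> q(1) by (auto simp: prime_dvd_mult_iff)
    then show ?thesis by (auto simp: cong_iff_dvd_diff)
  qed
  then have "card {d\<in>{1..M}. [int (d\<^sup>2 * m) = a] (mod int q)} \<le>
      card (?class (int e) \<union> ?class (- int e))"
    by (intro card_mono) auto
  also have "\<dots> \<le> card (?class (int e)) + card (?class (- int e))" by (rule card_Un_le)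
  also have "\<dots> \<le> (M div q + 1) + (M div q + 1)"
    by (intro add_mono card_cong_bounds(2) q(2))
  finally show ?thesis by simp
next
  case False
  then have "{d\<in>{1..M}. [int (d\<^sup>2 * m) = a] (mod int q)} = {}" by blast
  then show ?thesis by (simp only: card.empty)
qed

lemma multiples_cong_squareE:
  assumes "n \<in> multiples_cong N q a (d\<^sup>2)" "0 < D" "D < real d"
  obtains m where "n = d\<^sup>2 * m" "m \<in> {1..nat \<lfloor>real N / D\<^sup>2\<rfloor>}" "d \<in> {1..nat \<lfloor>sqrt N\<rfloor>}"
proof -
  obtain m where m: "n = d\<^sup>2 * m" using assms(1) by (auto simp: multiples_cong_def)
  have pos: "m > 0" "d > 0" using assms m by (auto simp: multiples_cong_def intro: Nat.gr0I)
  have "d\<^sup>2 * m \<le> N" using assms(1) m by (simp add: multiples_cong_def)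
  then have le: "real (d\<^sup>2 * m) \<le> real N" by (rule of_nat_mono)
  have "(real d)\<^sup>2 * 1 \<le> (real d)\<^sup>2 * real m" using pos by (intro mult_left_mono) auto
  also have "\<dots> = real (d\<^sup>2 * m)" by simp
  also have "\<dots> \<le> real N" by (rule le)
  finally have "(real d)\<^sup>2 \<le> real N" by (simp only: mult_1_right)
  then have d: "d \<le> nat \<lfloor>sqrt N\<rfloor>" by (intro le_nat_floor real_le_rsqrt)
  have "D\<^sup>2 * real m \<le> (real d)\<^sup>2 * real m"
    using assms by (intro mult_right_mono power_mono) auto
  then have "real m \<le> real N / D\<^sup>2" using le assms(2) by (simp add: field_simps)
  then show thesis using that[of m] m d pos by (simp add: le_nat_floor)
qed

lemma sum_card_multiples_cong_large_le:
  assumes "prime q" "coprime a (int q)" "D > 0"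
  shows "(\<Sum>d | d \<in> {1..N} \<and> D < real d. real (card (multiples_cong N q a (d\<^sup>2)))) \<le>
    real N / D\<^sup>2 * (2 * (sqrt N / real q + 1))"
proof -
  define M K where "M = nat \<lfloor>sqrt N\<rfloor>" and "K = nat \<lfloor>real N / D\<^sup>2\<rfloor>"
  let ?T = "{d. d \<in> {1..N} \<and> D < real d}"
  let ?roots = "\<lambda>m. {d\<in>{1..M}. [int (d\<^sup>2 * m) = a] (mod int q)}"
  have "Sigma ?T (\<lambda>d. multiples_cong N q a (d\<^sup>2)) \<subseteq> (\<lambda>(m, d). (d, d\<^sup>2 * m)) ` Sigma {1..K} ?roots"
  proof clarify
    fix d n assume d: "D < real d" and n: "n \<in> multiples_cong N q a (d\<^sup>2)"
    obtain m where m: "n = d\<^sup>2 * m" "m \<in> {1..K}" "d \<in> {1..M}"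
      using multiples_cong_squareE[OF n assms(3) d] unfolding K_def M_def by blast
    then have "(m, d) \<in> Sigma {1..K} ?roots" using n by (simp add: multiples_cong_def)
    then show "(d, n) \<in> (\<lambda>(m, d). (d, d\<^sup>2 * m)) ` Sigma {1..K} ?roots"
      using m(1) by (intro rev_image_eqI) auto
  qed
  then have "card (Sigma ?T (\<lambda>d. multiples_cong N q a (d\<^sup>2))) \<le> card (Sigma {1..K} ?roots)"
    by (intro surj_card_le finite_SigmaI) auto
  also have "\<dots> = (\<Sum>m\<in>{1..K}. card (?roots m))" by (intro card_SigmaI) auto
  also have "\<dots> \<le> (\<Sum>m\<in>{1..K}. 2 * (M div q + 1))"
    by (intro sum_mono card_square_roots_le assms)
  finally have "(\<Sum>d\<in>?T. card (multiples_cong N q a (d\<^sup>2))) \<le> K * (2 * (M div q + 1))"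
    by (subst (asm) card_SigmaI) auto
  then have "real (\<Sum>d\<in>?T. card (multiples_cong N q a (d\<^sup>2))) \<le> real (K * (2 * (M div q + 1)))"
    by (rule of_nat_mono)
  also have "\<dots> = real K * (2 * (real (M div q) + 1))"
    by (simp only: of_nat_mult of_nat_add of_nat_1 of_nat_numeral)
  also have "\<dots> \<le> real N / D\<^sup>2 * (2 * (sqrt N / real q + 1))"
  proof (intro mult_mono add_mono order.refl)
    have "real (M div q) \<le> real M / real q" by (rule of_nat_div_le_of_nat)
    also have "\<dots> \<le> sqrt N / real q" unfolding M_def by (intro divide_right_mono of_nat_floor) auto
    finally show "real (M div q) \<le> sqrt N / real q" .
  qed (auto simp: K_def intro: of_nat_floor)
  finally show ?thesis by simp
qed

lemma sum_inverse_squares_Ioc_le: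
  fixes k j :: nat
  assumes "k > 0"
  shows "(\<Sum>d\<in>{k<..k + j}. 1 / (real d)\<^sup>2) \<le> 1 / real k - 1 / real (k + j)"
proof (induction j)
  case (Suc j)
  have "1 / (real (k + Suc j))\<^sup>2 \<le> 1 / real (k + j) - 1 / real (k + Suc j)"
    using assms by (simp add: divide_simps power2_eq_square)
  moreover have "{k<..k + Suc j} = insert (k + Suc j) {k<..k + j}" by auto
  ultimately show ?case using Suc by simp
qed auto

lemma sum_inverse_squares_tail_le:
  assumes "D \<ge> 1"
  shows "(\<Sum>d | d \<in> {1..N} \<and> D < real d. 1 / (real d)\<^sup>2) \<le> 2 / D"
proof -
  define k where "k = nat \<lfloor>D\<rfloor>"
  have k: "k > 0" "real k \<le> D" "D < real k + 1" using assms unfolding k_def by linarith+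
  have "(\<Sum>d | d \<in> {1..N} \<and> D < real d. 1 / (real d)\<^sup>2) \<le> (\<Sum>d\<in>{k<..k + N}. 1 / (real d)\<^sup>2)"
    using k by (intro sum_mono2) auto
  also have "\<dots> \<le> 1 / real k - 1 / real (k + N)" using k(1) by (rule sum_inverse_squares_Ioc_le)
  also have "\<dots> \<le> 1 / real k" by simp
  also have "\<dots> \<le> 2 / D" using k by (simp add: field_simps)
  finally show ?thesis .
qed

definition middle_divisors :: "nat \<Rightarrow> nat \<Rightarrow> int \<Rightarrow> real \<Rightarrow> real \<Rightarrow> nat set" where
  "middle_divisors N q a D0 D1 =
     {d. squarefree d \<and> D0 < real d \<and> real d \<le> D1 \<and> multiples_cong N q a (d\<^sup>2) \<noteq> {}}"

lemma middle_divisors_subset: "D0 \<ge> 0 \<Longrightarrow> middle_divisors N q a D0 D1 \<subseteq> {1..nat \<lfloor>D1\<rfloor>}"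
  by (auto simp: middle_divisors_def le_nat_floor Suc_le_eq intro: Nat.gr0I)

lemma sum_discrepancy_small_divisors_le:
  assumes "prime q" "coprime a (int q)" "D \<ge> 0"
  shows "(\<Sum>d | d \<in> {1..N} \<and> real d \<le> D. \<bar>real_of_int (moebius_mu d) * discrepancy N q a (d\<^sup>2)\<bar>) \<le> D"
proof -
  let ?S = "{d. d \<in> {1..N} \<and> real d \<le> D}"
  have "(\<Sum>d\<in>?S. \<bar>real_of_int (moebius_mu d) * discrepancy N q a (d\<^sup>2)\<bar>) \<le> (\<Sum>d\<in>?S. 1 * 1)"
    unfolding abs_mult
    by (intro sum_mono mult_mono abs_discrepancy_le_1 assms)
      (auto simp: abs_moebius_mu simp flip: of_int_abs)
  also have "\<dots> = real (card ?S)" by simp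
  also have "\<dots> \<le> real (card {1..nat \<lfloor>D\<rfloor>})"
    by (intro of_nat_mono card_mono) (auto simp: le_nat_floor)
  also have "\<dots> \<le> D" using assms(3) by simp
  finally show ?thesis .
qed

lemma abs_moebius_mu_discrepancy_le:
  assumes "prime q" "coprime a (int q)" "d > 0" "D0 < real d"
  shows "\<bar>real_of_int (moebius_mu d) * discrepancy N q a (d\<^sup>2)\<bar> \<le>
    3 * real N / real q * (1 / (real d)\<^sup>2) + of_bool (d \<in> middle_divisors N q a D0 D1) +
    (if D1 < real d then real (card (multiples_cong N q a (d\<^sup>2))) else 0)"
proof (cases "squarefree d")
  case True
  define A B t where "A = real (card (multiples_cong N q a (d\<^sup>2)))"
    and "B = real (card (multiples_coprime N q (d\<^sup>2))) / real (totient q)"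
    and "t = real N / real q * (1 / (real d)\<^sup>2)"
  have t: "t \<ge> 0" "3 * real N / real q * (1 / (real d)\<^sup>2) = 3 * t" by (simp_all add: t_def)
  have "\<bar>real_of_int (moebius_mu d)\<bar> = 1" using True by (simp add: abs_moebius_mu flip: of_int_abs)
  then have "\<bar>real_of_int (moebius_mu d) * discrepancy N q a (d\<^sup>2)\<bar> = \<bar>A - B\<bar>"
    by (simp add: abs_mult discrepancy_def A_def B_def)
  also have "\<dots> \<le> \<bar>A\<bar> + \<bar>B\<bar>" by (rule abs_triangle_ineq4)
  also have "\<dots> = A + B" by (simp add: A_def B_def)
  also have "B \<le> 2 * t"
    using card_multiples_coprime_le[OF assms(1), of "d\<^sup>2" N] assms(3)
    by (simp add: B_def t_def mult.commute)
  finally have le: "\<bar>real_of_int (moebius_mu d) * discrepancy N q a (d\<^sup>2)\<bar> \<le> A + 2 * t" by simp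
  show ?thesis
  proof (cases "D1 < real d")
    case False
    then have "d \<in> middle_divisors N q a D0 D1 \<longleftrightarrow> multiples_cong N q a (d\<^sup>2) \<noteq> {}"
      using True assms(4) by (simp add: middle_divisors_def)
    then have "A \<le> t + of_bool (d \<in> middle_divisors N q a D0 D1)"
      using card_multiples_cong_le[OF assms(2), of "d\<^sup>2" N] assms(1,3) prime_gt_0_nat[of q]
      by (simp add: A_def t_def mult.commute)
    then show ?thesis using le False unfolding t(2) by simp
  next
    case True
    have "A + 2 * t \<le> 3 * t + of_bool (d \<in> middle_divisors N q a D0 D1) + A" using t(1) by simp
    with le True show ?thesis unfolding t(2) A_def by simp
  qed
qed (simp add: moebius_mu_def)

lemma abs_sum_discrepancy_le:
  assumes "prime q" "coprime a (int q)" "D0 \<ge> 1" "D1 \<ge> D0"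
  shows "\<bar>\<Sum>d\<in>{1..N}. real_of_int (moebius_mu d) * discrepancy N q a (d\<^sup>2)\<bar> \<le>
    D0 + 6 * real N / (real q * D0) + real (card (middle_divisors N q a D0 D1)) +
    real N / D1\<^sup>2 * (2 * (sqrt N / real q + 1))"
proof -
  let ?term = "\<lambda>d. \<bar>real_of_int (moebius_mu d) * discrepancy N q a (d\<^sup>2)\<bar>"
  let ?small = "{d. d \<in> {1..N} \<and> real d \<le> D0}" and ?large = "{d. d \<in> {1..N} \<and> D0 < real d}"
  have "\<bar>\<Sum>d\<in>{1..N}. real_of_int (moebius_mu d) * discrepancy N q a (d\<^sup>2)\<bar> \<le> (\<Sum>d\<in>{1..N}. ?term d)"
    by (rule sum_abs)
  also have "\<dots> = (\<Sum>d\<in>?small \<union> ?large. ?term d)" by (rule sum.cong) auto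
  also have "\<dots> = (\<Sum>d\<in>?small. ?term d) + (\<Sum>d\<in>?large. ?term d)"
    by (rule sum.union_disjoint) auto
  also have "(\<Sum>d\<in>?small. ?term d) \<le> D0"
    using assms by (intro sum_discrepancy_small_divisors_le) auto
  also have "(\<Sum>d\<in>?large. ?term d) \<le> (\<Sum>d\<in>?large. 3 * real N / real q * (1 / (real d)\<^sup>2) +
      of_bool (d \<in> middle_divisors N q a D0 D1) +
      (if D1 < real d then real (card (multiples_cong N q a (d\<^sup>2))) else 0))"
    using assms by (intro sum_mono abs_moebius_mu_discrepancy_le) auto
  also have "\<dots> = 3 * real N / real q * (\<Sum>d\<in>?large. 1 / (real d)\<^sup>2) +
      real (card (?large \<inter> middle_divisors N q a D0 D1)) +
      (\<Sum>d | d \<in> ?large \<and> D1 < real d. real (card (multiples_cong N q a (d\<^sup>2))))"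
    by (simp add: sum.distrib sum_of_bool_eq sum_distrib_left flip: sum.inter_filter)
  also have "\<dots> \<le> 3 * real N / real q * (2 / D0) + real (card (middle_divisors N q a D0 D1)) +
      real N / D1\<^sup>2 * (2 * (sqrt N / real q + 1))"
  proof (intro add_mono mult_left_mono of_nat_mono card_mono)
    show "(\<Sum>d\<in>?large. 1 / (real d)\<^sup>2) \<le> 2 / D0" by (rule sum_inverse_squares_tail_le) fact
    show "finite (middle_divisors N q a D0 D1)"
      using assms(3) by (intro finite_subset[OF middle_divisors_subset]) auto
    have "{d. d \<in> ?large \<and> D1 < real d} = {d. d \<in> {1..N} \<and> D1 < real d}" using assms(4) by auto
    then show "(\<Sum>d | d \<in> ?large \<and> D1 < real d. real (card (multiples_cong N q a (d\<^sup>2)))) \<le>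
        real N / D1\<^sup>2 * (2 * (sqrt N / real q + 1))"
      using sum_card_multiples_cong_large_le[OF assms(1,2), of D1 N] assms by (simp only:)
  qed auto
  finally show ?thesis by simp
qed

lemma abs_E_le:
  assumes "prime q" "coprime a (int q)" "X \<ge> 0" "D0 \<ge> 1" "D1 \<ge> D0"
  shows "\<bar>E X q a\<bar> \<le> D0 + 6 * X / (real q * D0) +
    real (card (middle_divisors (nat \<lfloor>X\<rfloor>) q a D0 D1)) + X / D1\<^sup>2 * (2 * (sqrt X / real q + 1))"
proof -
  let ?N = "nat \<lfloor>X\<rfloor>"
  have N: "real ?N \<le> X" using assms(3) by (rule of_nat_floor)
  have "\<bar>E X q a\<bar> \<le> D0 + 6 * real ?N / (real q * D0) + real (card (middle_divisors ?N q a D0 D1)) +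
      real ?N / D1\<^sup>2 * (2 * (sqrt ?N / real q + 1))"
    unfolding E_eq_sum_discrepancy using assms by (intro abs_sum_discrepancy_le) auto
  also have "\<dots> \<le> D0 + 6 * X / (real q * D0) + real (card (middle_divisors ?N q a D0 D1)) +
      X / D1\<^sup>2 * (2 * (sqrt X / real q + 1))"
    using N assms by (intro add_mono mult_mono divide_right_mono real_sqrt_le_mono order.refl) auto
  finally show ?thesis .
qed

subsection \<open>Middle divisors\<close>

lemma card_prime_factors_le_log:
  fixes n :: nat
  assumes "n > 0"
  shows "real (card (prime_factors n)) \<le> log 2 (real n)"
proof -
  have "2 ^ card (prime_factors n) = (\<Prod>p\<in>prime_factors n. 2 :: nat)" by simp
  also have "\<dots> \<le> \<Prod>(prime_factors n)"
    by (intro prod_mono) (auto dest: in_prime_factors_imp_prime prime_ge_2_nat)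
  also have "\<dots> \<le> n" using assms by (intro dvd_imp_le prod_primes_dvd) auto
  finally have "real (2 ^ card (prime_factors n)) \<le> real n" by (rule of_nat_mono)
  then show ?thesis using assms by (simp add: le_log_iff powr_realpow)
qed

lemma middle_divisors_multE:
  assumes "p * e \<in> middle_divisors N q a D0 D1" "D0 > 0" "real p \<le> P" "real N * P\<^sup>2 \<le> y * D0\<^sup>2"
  obtains t where "t > 0" "p dvd t" "real t \<le> y" "[int (e\<^sup>2 * t) = a] (mod int q)"
proof -
  obtain n where n: "n \<in> multiples_cong N q a ((p * e)\<^sup>2)" and lower: "D0 < real (p * e)"
    using assms(1) by (auto simp: middle_divisors_def)
  then obtain m where m: "n = (p * e)\<^sup>2 * m" by (auto simp: multiples_cong_def)
  show thesis
  proof (rule that[of "p\<^sup>2 * m"])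
    show "p\<^sup>2 * m > 0" using n m by (auto simp: multiples_cong_def intro: Nat.gr0I)
    show "p dvd p\<^sup>2 * m" by (simp add: power2_eq_square)
    show "[int (e\<^sup>2 * (p\<^sup>2 * m)) = a] (mod int q)"
      using n m by (simp add: multiples_cong_def power_mult_distrib mult_ac)
    have "D0\<^sup>2 * (real p)\<^sup>2 * real m \<le> (real (p * e))\<^sup>2 * (real p)\<^sup>2 * real m"
      using lower assms(2) by (intro mult_right_mono power_mono) auto
    also have "\<dots> = real n * (real p)\<^sup>2" by (simp add: m mult_ac)
    also have "\<dots> \<le> real N * P\<^sup>2"
      using n assms(3) by (intro mult_mono power_mono) (auto simp: multiples_cong_def)
    also have "\<dots> \<le> y * D0\<^sup>2" by (rule assms(4))
    finally have "real (p\<^sup>2 * m) * D0\<^sup>2 \<le> y * D0\<^sup>2" by (simp add: mult_ac)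
    then show "real (p\<^sup>2 * m) \<le> y" using assms(2) by simp
  qed
qed

lemma cong_mult_unique_less:
  fixes k t t' q :: nat
  assumes "coprime a (int q)" "[int (k * t) = a] (mod int q)" "[int (k * t') = a] (mod int q)"
    and "t < q" "t' < q"
  shows "t = t'"
proof -
  have "coprime (int (k * t)) (int q)" using assms(1,2) cong_imp_coprime cong_sym by blast
  then have "coprime k q" by simp
  have "[int (k * t) = int (k * t')] (mod int q)"
    using assms(2) cong_sym[OF assms(3)] by (rule cong_trans)
  then have "[t = t'] (mod q)"
    using \<open>coprime k q\<close> by (simp only: cong_int_iff cong_mult_lcancel_nat)
  then show ?thesis using assms(4,5) by (rule cong_less_modulus_unique_nat)
qed

lemma card_primes_in_middle_divisors_le:
  assumes "coprime a (int q)" "D0 > 0" "real N * P1\<^sup>2 \<le> y * D0\<^sup>2" "1 \<le> y" "y < real q"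
  shows "real (card {p\<in>primes_between P0 P1. p * e \<in> middle_divisors N q a D0 D1}) \<le> log 2 y"
proof (cases "{p\<in>primes_between P0 P1. p * e \<in> middle_divisors N q a D0 D1} = {}")
  case True
  then show ?thesis using assms(4) by (simp only: card.empty) simp
next
  case False
  let ?R = "{p\<in>primes_between P0 P1. p * e \<in> middle_divisors N q a D0 D1}"
  have cofactor: "\<exists>t>0. p dvd t \<and> real t \<le> y \<and> [int (e\<^sup>2 * t) = a] (mod int q)" if "p \<in> ?R" for p
  proof -
    have "p * e \<in> middle_divisors N q a D0 D1" "real p \<le> P1"
      using that by (auto simp: primes_between_def)
    then show ?thesis using assms(2,3) by (elim middle_divisors_multE) auto
  qed
  from False obtain p0 where "p0 \<in> ?R" by blast
  then obtain t where t: "t > 0" "real t \<le> y" "[int (e\<^sup>2 * t) = a] (mod int q)"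
    using cofactor by blast
  have "?R \<subseteq> prime_factors t"
  proof
    fix p assume p: "p \<in> ?R"
    then obtain t' where t': "p dvd t'" "real t' \<le> y" "[int (e\<^sup>2 * t') = a] (mod int q)"
      using cofactor by blast
    have "t' = t"
      by (rule cong_mult_unique_less[OF assms(1) t'(3) t(3)]) (use t(2) t'(2) assms(5) in linarith)+
    with p t' t(1) show "p \<in> prime_factors t" by (simp add: primes_between_def in_prime_factors_iff)
  qed
  then have "real (card ?R) \<le> real (card (prime_factors t))" by (intro of_nat_mono card_mono) auto
  also have "\<dots> \<le> log 2 (real t)" using t(1) by (rule card_prime_factors_le_log)
  also have "\<dots> \<le> log 2 y" using t by simp
  finally show ?thesis .
qed

lemma card_middle_divisors_with_prime_le:
  assumes "coprime a (int q)" "D0 > 0" "real N * P1\<^sup>2 \<le> y * D0\<^sup>2" "1 \<le> y" "y < real q"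
    and "P0 > 0" "D1 \<ge> 0"
  shows "real (card {d\<in>middle_divisors N q a D0 D1. \<exists>p\<in>primes_between P0 P1. p dvd d}) \<le>
    D1 / P0 * log 2 y"
proof -
  define K where "K = nat \<lfloor>D1 / P0\<rfloor>"
  let ?G = "{d\<in>middle_divisors N q a D0 D1. \<exists>p\<in>primes_between P0 P1. p dvd d}"
  let ?R = "\<lambda>e. {p\<in>primes_between P0 P1. p * e \<in> middle_divisors N q a D0 D1}"
  have "?G \<subseteq> (\<lambda>(e, p). p * e) ` Sigma {1..K} ?R"
  proof clarify
    fix d p assume d: "d \<in> middle_divisors N q a D0 D1" and p: "p \<in> primes_between P0 P1" "p dvd d"
    then obtain e where e: "d = p * e" by (auto elim: dvdE)
    have "e > 0" using d e assms(2) by (intro Nat.gr0I) (auto simp: middle_divisors_def)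
    moreover have "real e * P0 \<le> real e * real p"
      using p by (intro mult_left_mono) (auto simp: primes_between_def)
    then have "real e * P0 \<le> D1" using d e by (simp add: middle_divisors_def mult.commute)
    then have "e \<le> K" using assms(6) unfolding K_def by (intro le_nat_floor) (simp add: field_simps)
    ultimately have "(e, p) \<in> Sigma {1..K} ?R" using p d e by simp
    then show "d \<in> (\<lambda>(e, p). p * e) ` Sigma {1..K} ?R" using e by (intro rev_image_eqI) auto
  qed
  then have "card ?G \<le> card (Sigma {1..K} ?R)" by (intro surj_card_le finite_SigmaI) auto
  also have "\<dots> = (\<Sum>e\<in>{1..K}. card (?R e))" by (intro card_SigmaI) auto
  finally have "real (card ?G) \<le> (\<Sum>e\<in>{1..K}. real (card (?R e)))" by (simp flip: of_nat_sum)
  also have "\<dots> \<le> (\<Sum>e\<in>{1..K}. log 2 y)" by (intro sum_mono card_primes_in_middle_divisors_le assms)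
  also have "\<dots> = real K * log 2 y" by simp
  also have "\<dots> \<le> D1 / P0 * log 2 y"
    using assms unfolding K_def by (intro mult_right_mono of_nat_floor) auto
  finally show ?thesis .
qed

lemma prod_primes_outside_interval_le:
  assumes "1 \<le> P0" "P0 \<le> P1" "1 < P1" "P1 \<le> D"
  shows "(\<Prod>p\<in>primes_between 0 P0 \<union> primes_between P1 D. 1 + 1 / real p) \<le>
    2 * sqrt P0 * exp (4 * ln (2 * D / P1) / ln P1)"
proof -
  have "(\<Prod>p\<in>primes_between 0 P0 \<union> primes_between P1 D. 1 + 1 / real p) =
      (\<Prod>p\<in>primes_between 0 P0. 1 + 1 / real p) * (\<Prod>p\<in>primes_between P1 D. 1 + 1 / real p)"
    using assms(2) by (intro prod.union_disjoint primes_between_disjoint) auto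
  also have "\<dots> \<le> (2 * sqrt P0) * exp (4 * ln (2 * D / P1) / ln P1)"
  proof (rule mult_mono)
    show "(\<Prod>p\<in>primes_between 0 P0. 1 + 1 / real p) \<le> 2 * sqrt P0"
      by (rule prod_one_plus_inverse_primes_le) fact
    have "(\<Prod>p\<in>primes_between P1 D. 1 + 1 / real p) \<le> (\<Prod>p\<in>primes_between P1 D. exp (1 / real p))"
      by (intro prod_mono conjI exp_ge_add_one_self) auto
    also have "\<dots> = exp (\<Sum>p\<in>primes_between P1 D. 1 / real p)" by (simp add: exp_sum)
    finally show "(\<Prod>p\<in>primes_between P1 D. 1 + 1 / real p) \<le> exp (4 * ln (2 * D / P1) / ln P1)"
      by (rule order_trans) (use sum_inverse_primes_between_le[OF assms(3,4)] in simp)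
  qed (use assms in \<open>auto intro!: prod_nonneg\<close>)
  finally show ?thesis .
qed

lemma card_middle_divisors_without_prime_le:
  assumes "1 < D0" "1 \<le> P0" "P0 \<le> P1" "1 < P1" "P1 \<le> D1"
  shows "real (card {d\<in>middle_divisors N q a D0 D1. \<forall>p\<in>primes_between P0 P1. \<not> p dvd d}) \<le>
    ln 4 * D1 / ln D0 * (2 * sqrt P0 * exp (4 * ln (2 * D1 / P1) / ln P1))"
proof -
  let ?P = "primes_between 0 P0 \<union> primes_between P1 D1"
  let ?S = "{d\<in>squarefree_over ?P. D0 < real d \<and> real d \<le> D1}"
  have P: "finite ?P" "\<And>p. p \<in> ?P \<Longrightarrow> prime p" by (auto dest: prime_primes_between)
  have "{d\<in>middle_divisors N q a D0 D1. \<forall>p\<in>primes_between P0 P1. \<not> p dvd d} \<subseteq> ?S"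
  proof
    fix d assume d: "d \<in> {d\<in>middle_divisors N q a D0 D1. \<forall>p\<in>primes_between P0 P1. \<not> p dvd d}"
    then have range: "squarefree d" "D0 < real d" "real d \<le> D1"
      by (auto simp: middle_divisors_def)
    have "prime_factors d \<subseteq> ?P"
    proof
      fix p assume p: "p \<in> prime_factors d"
      then have "prime p" "p dvd d" by auto
      then have "real p \<le> real d"
        using range(2) assms(1) by (intro of_nat_mono dvd_imp_le Nat.gr0I) auto
      moreover have "p \<notin> primes_between P0 P1" using d \<open>p dvd d\<close> by blast
      ultimately show "p \<in> ?P"
        using \<open>prime p\<close> range(3) by (auto simp: primes_between_def prime_gt_0_nat)
    qed
    with range show "d \<in> ?S" by (simp add: squarefree_over_def)
  qed
  then have "real (card {d\<in>middle_divisors N q a D0 D1. \<forall>p\<in>primes_between P0 P1. \<not> p dvd d}) \<le>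
      real (card ?S)"
    using finite_squarefree_over[OF P] by (intro of_nat_mono card_mono) auto
  also have "\<dots> \<le> ln 4 * D1 / ln D0 * (\<Prod>p\<in>?P. 1 + 1 / real p)"
    using assms by (intro card_squarefree_over_between_le P) auto
  also have "\<dots> \<le> ln 4 * D1 / ln D0 * (2 * sqrt P0 * exp (4 * ln (2 * D1 / P1) / ln P1))"
    using assms by (intro mult_left_mono prod_primes_outside_interval_le) auto
  finally show ?thesis .
qed

lemma card_middle_divisors_le:
  assumes "coprime a (int q)" "real N * P1\<^sup>2 \<le> y * D0\<^sup>2" "1 \<le> y" "y < real q"
    and "1 < D0" "1 \<le> P0" "P0 \<le> P1" "1 < P1" "P1 \<le> D1"
  shows "real (card (middle_divisors N q a D0 D1)) \<le>
    ln 4 * D1 / ln D0 * (2 * sqrt P0 * exp (4 * ln (2 * D1 / P1) / ln P1)) + D1 / P0 * log 2 y"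
proof -
  let ?without = "{d\<in>middle_divisors N q a D0 D1. \<forall>p\<in>primes_between P0 P1. \<not> p dvd d}"
  let ?with = "{d\<in>middle_divisors N q a D0 D1. \<exists>p\<in>primes_between P0 P1. p dvd d}"
  have "middle_divisors N q a D0 D1 = ?without \<union> ?with" by blast
  then have "card (middle_divisors N q a D0 D1) \<le> card ?without + card ?with"
    using card_Un_le[of ?without ?with] by (simp only:)
  then have "real (card (middle_divisors N q a D0 D1)) \<le> real (card ?without) + real (card ?with)"
    by linarith
  then show ?thesis
    using card_middle_divisors_without_prime_le[OF assms(5-9), of N q a]
      card_middle_divisors_with_prime_le[OF assms(1) _ assms(2-4), of P0 D1] assms(5-9) by simp
qed

subsection \<open>Choice of parameters\<close>

text \<open>The exponents make both \<open>X / D1\<^sup>2\<close> and \<open>D1 * sqrt P0 / ln X\<close> equal to \<open>D0\<close>. The exponent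
  of \<open>P1\<close> only has to be less than \<open>1/12\<close>, so that \<open>X * P1\<^sup>2 / D0\<^sup>2\<close> stays below \<open>sqrt X\<close>.\<close>

definition lower_cutoff :: "real \<Rightarrow> real" where
  "lower_cutoff X = X powr (1 / 3) / ln X powr (1 / 6)"

definition upper_cutoff :: "real \<Rightarrow> real" where
  "upper_cutoff X = lower_cutoff X * ln X powr (1 / 4)"

definition lower_prime :: "real \<Rightarrow> real" where
  "lower_prime X = ln X powr (3 / 2)"

definition upper_prime :: "real \<Rightarrow> real" where
  "upper_prime X = X powr (1 / 24)"

lemmas parameter_defs = upper_cutoff_def lower_cutoff_def lower_prime_def upper_prime_def

abbreviation critical_divisors :: "real \<Rightarrow> nat \<Rightarrow> int \<Rightarrow> nat set" where
  "critical_divisors X q a \<equiv>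
     middle_divisors (nat \<lfloor>X\<rfloor>) q a (lower_cutoff X) (upper_cutoff X)"

definition sieve_constant :: real where
  "sieve_constant = 8 * ln 4 * exp 30 + 1"

lemma sieve_constant_pos: "sieve_constant > 0"
  by (simp add: sieve_constant_def add_nonneg_pos)

definition error_scale :: "real \<Rightarrow> nat \<Rightarrow> real" where
  "error_scale X q = lower_cutoff X + X / (real q * ln X)"

lemma card_middle_divisors_le_upper:
  assumes "D0 \<ge> 0" "D1 \<ge> 0"
  shows "real (card (middle_divisors N q a D0 D1)) \<le> D1"
proof -
  have "card (middle_divisors N q a D0 D1) \<le> card {1..nat \<lfloor>D1\<rfloor>}"
    using assms(1) by (intro card_mono middle_divisors_subset) auto
  then show ?thesis using of_nat_floor[OF assms(2)] by simp
qed

lemma eventually_card_critical_divisors_small_modulus: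
  "\<forall>\<^sub>F X in at_top. \<forall>q a. 0 < q \<and> real q \<le> sqrt X \<longrightarrow>
    real (card (critical_divisors X q a)) \<le> X / (real q * ln X)"
proof -
  have "\<forall>\<^sub>F X in at_top. 1 < X \<and> 0 \<le> lower_cutoff X \<and> 0 \<le> upper_cutoff X \<and>
      upper_cutoff X \<le> sqrt X / ln X"
    unfolding parameter_defs by (intro eventually_conj; real_asymp)
  then show ?thesis
  proof eventually_elim
    case (elim X)
    show ?case
    proof (intro allI impI)
      fix q :: nat and a :: int assume q: "0 < q \<and> real q \<le> sqrt X"
      have "real (card (critical_divisors X q a)) \<le> upper_cutoff X"
        using elim by (intro card_middle_divisors_le_upper) auto
      also have "\<dots> \<le> sqrt X / ln X" using elim by blast
      also have "\<dots> \<le> X / real q / ln X"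
      proof (rule divide_right_mono)
        have "sqrt X * real q \<le> sqrt X * sqrt X" using q elim by (intro mult_left_mono) auto
        then show "sqrt X \<le> X / real q" using q elim by (simp add: field_simps)
      qed (use elim in auto)
      finally show "real (card (critical_divisors X q a)) \<le> X / (real q * ln X)" by simp
    qed
  qed
qed

lemma eventually_card_critical_divisors_large_modulus:
  "\<forall>\<^sub>F X in at_top. \<forall>q a. sqrt X < real q \<and> coprime a (int q) \<longrightarrow>
    real (card (critical_divisors X q a)) \<le> sieve_constant * lower_cutoff X"
proof -
  have "\<forall>\<^sub>F X in at_top. 1 < X \<and> 1 < lower_cutoff X \<and>
      1 \<le> lower_prime X \<and> lower_prime X \<le> upper_prime X \<and>
      1 < upper_prime X \<and> upper_prime X \<le> upper_cutoff X"
    unfolding parameter_defs by (intro eventually_conj; real_asymp)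
  moreover have "\<forall>\<^sub>F X in at_top. X * (upper_prime X)\<^sup>2 \<le> sqrt X * (lower_cutoff X)\<^sup>2"
    unfolding parameter_defs by real_asymp
  moreover have "\<forall>\<^sub>F X in at_top.
      upper_cutoff X / ln (lower_cutoff X) * sqrt (lower_prime X) \<le> 4 * lower_cutoff X"
    unfolding parameter_defs by real_asymp
  moreover have "\<forall>\<^sub>F X in at_top.
      4 * ln (2 * upper_cutoff X / upper_prime X) / ln (upper_prime X) \<le> 30"
    unfolding parameter_defs by real_asymp
  moreover have "\<forall>\<^sub>F X in at_top. upper_cutoff X / lower_prime X * log 2 (sqrt X) \<le> lower_cutoff X"
    unfolding parameter_defs by real_asymp
  ultimately show ?thesis
  proof eventually_elim
    case (elim X)
    let ?D0 = "lower_cutoff X" and ?D1 = "upper_cutoff X"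
      and ?P0 = "lower_prime X" and ?P1 = "upper_prime X"
    show ?case
    proof (intro allI impI)
      fix q :: nat and a :: int assume q: "sqrt X < real q \<and> coprime a (int q)"
      have "real (nat \<lfloor>X\<rfloor>) * ?P1\<^sup>2 \<le> X * ?P1\<^sup>2" using elim by (intro mult_right_mono) auto
      also have "\<dots> \<le> sqrt X * ?D0\<^sup>2" by (rule elim)
      finally have "real (card (critical_divisors X q a)) \<le>
          ln 4 * ?D1 / ln ?D0 * (2 * sqrt ?P0 * exp (4 * ln (2 * ?D1 / ?P1) / ln ?P1)) +
          ?D1 / ?P0 * log 2 (sqrt X)"
        using elim q by (intro card_middle_divisors_le) auto
      also have "\<dots> \<le> ln 4 * ?D1 / ln ?D0 * (2 * sqrt ?P0 * exp 30) + ?D0"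
        using elim by (intro add_mono mult_left_mono) auto
      also have "\<dots> = 2 * ln 4 * exp 30 * (?D1 / ln ?D0 * sqrt ?P0) + ?D0" by (simp add: mult_ac)
      also have "\<dots> \<le> 2 * ln 4 * exp 30 * (4 * ?D0) + ?D0"
        by (intro add_right_mono mult_left_mono elim) auto
      finally show "real (card (critical_divisors X q a)) \<le> sieve_constant * ?D0"
        by (simp add: sieve_constant_def algebra_simps)
    qed
  qed
qed

lemma eventually_card_critical_divisors_le:
  "\<forall>\<^sub>F X in at_top. \<forall>q a. prime q \<and> coprime a (int q) \<longrightarrow>
    real (card (critical_divisors X q a)) \<le>
      sieve_constant * lower_cutoff X + X / (real q * ln X)"
proof -
  have "\<forall>\<^sub>F X in at_top. 1 < X \<and> 0 \<le> lower_cutoff X"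
    unfolding parameter_defs by (intro eventually_conj; real_asymp)
  then show ?thesis
    using eventually_card_critical_divisors_small_modulus
      eventually_card_critical_divisors_large_modulus
  proof eventually_elim
    case (elim X)
    show ?case
    proof (intro allI impI)
      fix q :: nat and a :: int assume qa: "prime q \<and> coprime a (int q)"
      have nonneg: "0 \<le> sieve_constant * lower_cutoff X" "0 \<le> X / (real q * ln X)"
        using elim(1) sieve_constant_pos by simp_all
      show "real (card (critical_divisors X q a)) \<le>
          sieve_constant * lower_cutoff X + X / (real q * ln X)"
      proof (cases "real q \<le> sqrt X")
        case True
        then have "0 < q \<and> real q \<le> sqrt X" using qa prime_gt_0_nat by blast
        with elim(2) nonneg(1) show ?thesis by (intro add_increasing) auto
      next
        case False
        then have "sqrt X < real q \<and> coprime a (int q)" using qa by simp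
        with elim(3) nonneg(2) show ?thesis by (intro add_increasing2) auto
      qed
    qed
  qed
qed

lemma eventually_tail_terms_le:
  "\<forall>\<^sub>F X in at_top. \<forall>q. 6 * X / (real q * lower_cutoff X) +
      X / (upper_cutoff X)\<^sup>2 * (2 * (sqrt X / real q + 1)) \<le>
    4 * lower_cutoff X + 2 * (X / (real q * ln X))"
proof -
  have "\<forall>\<^sub>F X in at_top. 0 \<le> X \<and> 6 / lower_cutoff X \<le> 1 / ln X"
    unfolding parameter_defs by (intro eventually_conj; real_asymp)
  moreover have "\<forall>\<^sub>F X in at_top. X / (upper_cutoff X)\<^sup>2 \<le> 2 * lower_cutoff X"
    unfolding parameter_defs by real_asymp
  moreover have "\<forall>\<^sub>F X in at_top. 2 * sqrt X / (upper_cutoff X)\<^sup>2 \<le> 1 / ln X"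
    unfolding parameter_defs by real_asymp
  ultimately show ?thesis
  proof eventually_elim
    case (elim X)
    let ?D0 = "lower_cutoff X" and ?D1 = "upper_cutoff X"
    have "6 * X / (real q * ?D0) + X / ?D1\<^sup>2 * (2 * (sqrt X / real q + 1)) \<le>
        4 * ?D0 + 2 * (X / (real q * ln X))" for q
    proof -
      have "6 * X / (real q * ?D0) + X / ?D1\<^sup>2 * (2 * (sqrt X / real q + 1)) =
          X / real q * (6 / ?D0) + X / real q * (2 * sqrt X / ?D1\<^sup>2) + 2 * (X / ?D1\<^sup>2)"
        by (simp add: algebra_simps)
      also have "\<dots> \<le> X / real q * (1 / ln X) + X / real q * (1 / ln X) + 2 * (2 * ?D0)"
        using elim by (intro add_mono mult_left_mono) auto
      finally show ?thesis by simp
    qed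
    then show ?case by blast
  qed
qed

lemma eventually_abs_E_le:
  "\<forall>\<^sub>F X in at_top. \<forall>q a. prime q \<and> coprime a (int q) \<longrightarrow>
    \<bar>E X q a\<bar> \<le> (sieve_constant + 5) * error_scale X q"
proof -
  have "\<forall>\<^sub>F X in at_top. 1 < X \<and> 1 < lower_cutoff X \<and> lower_cutoff X \<le> upper_cutoff X"
    unfolding parameter_defs by (intro eventually_conj; real_asymp)
  then show ?thesis using eventually_card_critical_divisors_le eventually_tail_terms_le
  proof eventually_elim
    case (elim X)
    let ?D0 = "lower_cutoff X" and ?D1 = "upper_cutoff X"
    show ?case
    proof (intro allI impI)
      fix q :: nat and a :: int assume qa: "prime q \<and> coprime a (int q)"
      define Z where "Z = X / (real q * ln X)"
      have "real (card (critical_divisors X q a)) \<le> sieve_constant * ?D0 + Z"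
        using elim(2) qa by (simp add: Z_def)
      moreover have "6 * X / (real q * ?D0) + X / ?D1\<^sup>2 * (2 * (sqrt X / real q + 1)) \<le>
          4 * ?D0 + 2 * Z"
        using elim(3) by (simp add: Z_def)
      moreover have "\<bar>E X q a\<bar> \<le> ?D0 + 6 * X / (real q * ?D0) +
          real (card (critical_divisors X q a)) + X / ?D1\<^sup>2 * (2 * (sqrt X / real q + 1))"
        using elim(1) qa by (intro abs_E_le) auto
      ultimately have "\<bar>E X q a\<bar> \<le> (sieve_constant + 5) * ?D0 + 3 * Z" by (simp add: algebra_simps)
      also have "\<dots> \<le> (sieve_constant + 5) * ?D0 + (sieve_constant + 5) * Z"
        using elim(1) sieve_constant_pos
        by (intro add_left_mono mult_right_mono) (auto simp: Z_def)
      also have "\<dots> = (sieve_constant + 5) * error_scale X q"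
        by (simp add: error_scale_def Z_def algebra_simps)
      finally show "\<bar>E X q a\<bar> \<le> (sieve_constant + 5) * error_scale X q" .
    qed
  qed
qed

lemma abs_E_le_self:
  assumes "prime q" "coprime a (int q)" "X \<ge> 0"
  shows "\<bar>E X q a\<bar> \<le> X"
proof -
  let ?N = "nat \<lfloor>X\<rfloor>"
  have "\<bar>E X q a\<bar> \<le> (\<Sum>d\<in>{1..?N}. \<bar>real_of_int (moebius_mu d) * discrepancy ?N q a (d\<^sup>2)\<bar>)"
    unfolding E_eq_sum_discrepancy by (rule sum_abs)
  also have "{1..?N} = {d. d \<in> {1..?N} \<and> real d \<le> X}"
    using of_nat_floor[OF assms(3)] by auto
  also have "(\<Sum>d\<in>\<dots>. \<bar>real_of_int (moebius_mu d) * discrepancy ?N q a (d\<^sup>2)\<bar>) \<le> X"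
    by (rule sum_discrepancy_small_divisors_le) fact+
  finally show ?thesis .
qed

lemma error_scale_ge_1:
  assumes "X > 3"
  shows "error_scale X q \<ge> 1"
proof -
  have lnX: "1 < ln X" using assms ln3_gt_1 ln_less_cancel_iff[of 3 X] by linarith
  have "ln X powr (1 / 6) \<le> ln X powr (1 / 3)" using lnX by (intro powr_mono) auto
  also have "\<dots> \<le> X powr (1 / 3)"
    using lnX assms by (intro powr_mono2 less_imp_le[OF ln_less_self]) auto
  finally have "lower_cutoff X \<ge> 1" using lnX by (simp add: lower_cutoff_def)
  then show ?thesis using lnX assms by (simp add: error_scale_def add_increasing2)
qed

lemma abs_E_le_error_scale:
  obtains C where "C \<ge> 0"
    "\<And>X q a. X > 3 \<Longrightarrow> prime q \<Longrightarrow> coprime a (int q) \<Longrightarrow> \<bar>E X q a\<bar> \<le> C * error_scale X q"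
proof -
  define C0 :: real where "C0 = sieve_constant + 5"
  obtain X0 where X0:
    "\<And>X q a. X \<ge> X0 \<Longrightarrow> prime q \<Longrightarrow> coprime a (int q) \<Longrightarrow> \<bar>E X q a\<bar> \<le> C0 * error_scale X q"
    using eventually_abs_E_le unfolding eventually_at_top_linorder C0_def by blast
  show thesis
  proof (rule that[of "max C0 X0"])
    show "max C0 X0 \<ge> 0" by (simp add: C0_def le_max_iff_disj sieve_constant_pos less_imp_le)
    fix X :: real and q :: nat and a :: int assume X: "X > 3" and qa: "prime q" "coprime a (int q)"
    have scale: "error_scale X q \<ge> 1" using X by (rule error_scale_ge_1)
    show "\<bar>E X q a\<bar> \<le> max C0 X0 * error_scale X q"
    proof (cases "X \<ge> X0")
      case True
      then have "\<bar>E X q a\<bar> \<le> C0 * error_scale X q" using qa by (rule X0)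
      also have "\<dots> \<le> max C0 X0 * error_scale X q" using scale by (intro mult_right_mono) auto
      finally show ?thesis .
    next
      case False
      have "\<bar>E X q a\<bar> \<le> X" using qa X by (intro abs_E_le_self) auto
      also have "\<dots> \<le> max C0 X0 * 1" using False by simp
      also have "\<dots> \<le> max C0 X0 * error_scale X q"
        using scale False X by (intro mult_left_mono) auto
      finally show ?thesis .
    qed
  qed
qed

text \<open>Near \<open>X = 3\<close> the factors \<open>ln (ln X)\<close> are smaller than \<open>1\<close>, whence the constant.\<close>

lemma error_scale_le:
  fixes \<gamma> X :: real
  assumes "0 \<le> \<gamma>" "\<gamma> \<le> 2" "X > 3" "q > 0"
  shows "min (ln (ln 3) powr (7 / 3)) ((ln (ln 3))\<^sup>2) * error_scale X q \<le>
    X powr (1 / 3) * ln (ln X) powr (7 / 3) / ln X powr (1 / 6 - \<gamma> / 3) +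
    X * (ln (ln X))\<^sup>2 / (real q * ln X powr (\<gamma> / 2))"
proof -
  let ?\<kappa> = "min (ln (ln 3) powr (7 / 3)) ((ln (ln 3))\<^sup>2) :: real"
  have "ln 3 < ln X" using assms(3) by simp
  then have lnX: "1 < ln X" and lnlnX: "0 < ln (ln (3::real))" "ln (ln 3) \<le> ln (ln X)"
    using ln3_gt_1 by simp_all
  have "?\<kappa> * lower_cutoff X = X powr (1 / 3) * ?\<kappa> / ln X powr (1 / 6)"
    by (simp add: lower_cutoff_def)
  also have "\<dots> \<le> X powr (1 / 3) * ln (ln X) powr (7 / 3) / ln X powr (1 / 6 - \<gamma> / 3)"
  proof (intro frac_le mult_left_mono)
    show "?\<kappa> \<le> ln (ln X) powr (7 / 3)"
      using lnlnX by (intro min.coboundedI1 powr_mono2) auto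
    show "ln X powr (1 / 6 - \<gamma> / 3) \<le> ln X powr (1 / 6)"
      using lnX assms(1) by (intro powr_mono) auto
  qed (use lnX in auto)
  finally have main: "?\<kappa> * lower_cutoff X \<le>
    X powr (1 / 3) * ln (ln X) powr (7 / 3) / ln X powr (1 / 6 - \<gamma> / 3)" .
  have "?\<kappa> * (X / (real q * ln X)) = X * ?\<kappa> / (real q * ln X powr 1)" using lnX by simp
  also have "\<dots> \<le> X * (ln (ln X))\<^sup>2 / (real q * ln X powr (\<gamma> / 2))"
  proof (intro frac_le mult_left_mono)
    show "?\<kappa> \<le> (ln (ln X))\<^sup>2" using lnlnX by (intro min.coboundedI2 power_mono) auto
    show "ln X powr (\<gamma> / 2) \<le> ln X powr 1" using lnX assms(2) by (intro powr_mono) auto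
  qed (use lnX assms in auto)
  finally show ?thesis using main unfolding error_scale_def distrib_left by (rule add_mono[rotated])
qed

theorem theorem4:
  shows "\<forall>\<gamma>::real. 0 < \<gamma> \<and> \<gamma> < 1 / 2 \<longrightarrow>
    (\<exists>C::real. \<forall>(X::real) (q::nat) (a::int).
      X > 3 \<and> prime q \<and> coprime a (int q) \<longrightarrow>
      \<bar>E X q a\<bar> \<le> C *
        (X powr (1 / 3) * ln (ln X) powr (7 / 3) / ln X powr (1 / 6 - \<gamma> / 3)
         + X * (ln (ln X))\<^sup>2 / (real q * ln X powr (\<gamma> / 2))))"
    (is "\<forall>\<gamma>. _ \<longrightarrow> (\<exists>C. \<forall>X q a. _ \<longrightarrow> _ \<le> C * ?bound \<gamma> X q)")
proof (intro allI impI)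
  fix \<gamma> :: real assume \<gamma>: "0 < \<gamma> \<and> \<gamma> < 1 / 2"
  obtain C where C: "C \<ge> 0"
    "\<And>X q a. X > 3 \<Longrightarrow> prime q \<Longrightarrow> coprime a (int q) \<Longrightarrow> \<bar>E X q a\<bar> \<le> C * error_scale X q"
    using abs_E_le_error_scale by blast
  define \<kappa> :: real where "\<kappa> = min (ln (ln 3) powr (7 / 3)) ((ln (ln 3))\<^sup>2)"
  have \<kappa>: "\<kappa> > 0" using ln3_gt_1 by (simp add: \<kappa>_def)
  have "\<bar>E X q a\<bar> \<le> C / \<kappa> * ?bound \<gamma> X q" if "X > 3 \<and> prime q \<and> coprime a (int q)" for X q a
  proof -
    have "\<bar>E X q a\<bar> \<le> C / \<kappa> * (\<kappa> * error_scale X q)" using C(2)[of X q a] that \<kappa> by simp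
    also have "\<dots> \<le> C / \<kappa> * ?bound \<gamma> X q"
      unfolding \<kappa>_def using \<gamma> that C(1) \<kappa>
      by (intro mult_left_mono error_scale_le) (auto simp: prime_gt_0_nat \<kappa>_def)
    finally show ?thesis .
  qed
  then show "\<exists>C. \<forall>X q a. X > 3 \<and> prime q \<and> coprime a (int q) \<longrightarrow> \<bar>E X q a\<bar> \<le> C * ?bound \<gamma> X q"
    by blast
qed

end
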